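(* Let $J_N$ be a real symmetric $N\times N$ matrix with zero diagonal and non-negative entries, with eigenvalues $\lambda_1(J_N)\le\lambda_2(J_N)\le\cdots\le\lambda_N(J_N)$ and ($\ell_2$) operator norm $\|J_N\|$. (a) For $0<\beta<\frac{1}{\|J_N\|}$, $$F_N(\beta)\le-\frac12\sum_{i=1}^N\log\big(1-\beta\lambda_i(J_N)\big).$$ (b) For any $\beta>0$, $$F_N(\beta)\ge\sum_{1\le i<j\le N}\log\cosh\big(\beta J_N(i,j)\big).$$
   Context: With $S_N=\{-1,1\}^N$, the log-partition function is $F_N(\beta)=\log\big\{2^{-N}\sum_{\tau\in S_N}e^{\frac12\beta\tau'J_N\tau}\big\}$, where $\tau'J_N\tau=\sum_{1\le i,j\le N}J_N(i,j)\tau_i\tau_j$. *)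

theory Defs
  imports
    "HOL-Library.Extended_Real"
    "HOL-Library.FuncSet"
    "Jordan_Normal_Form.Char_Poly"
begin

text \<open>Matrix rows and columns and spin sites are numbered from 0, so the index set
  \<open>1, \<dots>, N\<close> becomes \<open>{..<N}\<close>.\<close>

definition spins :: "nat \<Rightarrow> (nat \<Rightarrow> real) set" where
  "spins N = {..<N} \<rightarrow>\<^sub>E {-1, 1}"

definition quad_form :: "nat \<Rightarrow> real mat \<Rightarrow> (nat \<Rightarrow> real) \<Rightarrow> real" where
  "quad_form N J \<tau> = (\<Sum>i<N. \<Sum>j<N. J $$ (i, j) * \<tau> i * \<tau> j)"

definition log_partition :: "nat \<Rightarrow> real mat \<Rightarrow> real \<Rightarrow> real" where
  "log_partition N J \<beta> =
     ln ((1 / 2 ^ N) * (\<Sum>\<tau>\<in>spins N. exp (1 / 2 * \<beta> * quad_form N J \<tau>)))"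

text \<open>The real eigenvalues in increasing order, repeated according to algebraic multiplicity.
  For a symmetric matrix of dimension \<open>N\<close> the list has length \<open>N\<close>.\<close>

definition sorted_eigenvalues :: "real mat \<Rightarrow> real list" where
  "sorted_eigenvalues A = sorted_list_of_multiset (proots (char_poly A))"

definition vec_l2_norm :: "real vec \<Rightarrow> real" where
  "vec_l2_norm v = sqrt (v \<bullet> v)"

text \<open>The supremum is over the closed unit ball rather than the unit sphere, so that the set
  is non-empty in dimension 0 as well.\<close>

definition l2_op_norm :: "real mat \<Rightarrow> real" where
  "l2_op_norm A =
     (SUP v \<in> {v \<in> carrier_vec (dim_col A). vec_l2_norm v \<le> 1}. vec_l2_norm (A *\<^sub>v v))"

end

theory Submission
  imports Defs "HOL-Analysis.L2_Norm"
begin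

text \<open>
  For (a), write \<open>A = \<beta>J\<close>, so that \<open>I - A\<close> is positive definite, and average out one spin at a
  time. If \<open>a \<ge> 0\<close> is the last diagonal entry, \<open>b\<close> the rest of the last column and \<open>s = b'\<tau>\<close>,
  then \<open>exp (a / 2) cosh s \<le> exp (s\<^sup>2 / (2 (1 - a))) / sqrt (1 - a)\<close>. The right-hand side
  replaces \<open>A\<close> by \<open>A + b b' / (1 - a)\<close> on the remaining spins, which is exactly the Schur
  complement step for \<open>I - A\<close>; it keeps the diagonal non-negative. Induction gives the bound
  \<open>1 / sqrt (det (I - A))\<close>, the value that a Gaussian integral would give, and the determinant is \<open>\<Prod>(1 - \<beta>\<lambda>\<^sub>i)\<close>.

  For (b), \<open>exp (\<beta>J\<^sub>i\<^sub>j\<tau>\<^sub>i\<tau>\<^sub>j) = cosh (\<beta>J\<^sub>i\<^sub>j) + sinh (\<beta>J\<^sub>i\<^sub>j) \<tau>\<^sub>i\<tau>\<^sub>j\<close>. Expanding the product over all pairs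
  yields non-negative multiples of spin monomials, whose averages are non-negative, so the average
  is at least the term in which every factor contributes its \<open>cosh\<close>.
\<close>

section \<open>Spin configurations and symmetric entries\<close>

lemma card_spins: "card (spins N) = 2 ^ N"
  by (simp add: spins_def card_PiE card_insert_if numeral_2_eq_2)

lemma spins_values: "\<tau> \<in> spins N \<Longrightarrow> i < N \<Longrightarrow> \<tau> i = -1 \<or> \<tau> i = 1"
  by (auto simp: spins_def PiE_iff)

lemma symmetric_mat_index:
  assumes "J \<in> carrier_mat N N" "transpose_mat J = J" "i < N" "j < N"
  shows "J $$ (i, j) = J $$ (j, i)"
  using assms index_transpose_mat(1)[of j J i] by auto

subsection \<open>Lower bound\<close>

text \<open>The sum over the cube factorises over sites, and site \<open>i\<close> contributes
  \<open>(-1) ^ m i + 1\<close>, which is 0 or 2.\<close>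

lemma sum_spins_monomial_nonneg: "0 \<le> (\<Sum>\<tau>\<in>spins N. \<Prod>i<N. \<tau> i ^ m i)"
proof -
  have "(\<Sum>\<tau>\<in>spins N. \<Prod>i<N. \<tau> i ^ m i) = (\<Prod>i<N. \<Sum>x\<in>{-1, 1::real}. x ^ m i)"
    unfolding spins_def by (rule prod_sum_PiE[symmetric]) auto
  also have "\<dots> \<ge> 0"
    by (intro prod_nonneg) (auto simp: minus_one_power_iff)
  finally show ?thesis .
qed

lemma prod_power_indicator:
  fixes x :: "nat \<Rightarrow> real"
  assumes "k < N"
  shows "(\<Prod>i<N. x i ^ (if i = k then 1 else 0)) = x k"
  using assms by (simp add: if_distrib prod.delta cong: if_cong)

text \<open>This is Griffiths' first inequality in product form. Expanding one factor leaves two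
  sums of the same shape with one factor fewer, the second with its monomial multiplied by two
  spins. The exponents \<open>m\<close> are therefore left arbitrary in the induction.\<close>

lemma griffiths_nonneg:
  assumes "finite E" "E \<subseteq> {..<N} \<times> {..<N}"
    and "\<And>e. e \<in> E \<Longrightarrow> 0 \<le> c e" "\<And>e. e \<in> E \<Longrightarrow> 0 \<le> s e"
  shows "0 \<le> (\<Sum>\<tau>\<in>spins N. (\<Prod>i<N. \<tau> i ^ m i) * (\<Prod>e\<in>E. c e + s e * (\<tau> (fst e) * \<tau> (snd e))))"
  using assms
proof (induction E arbitrary: m rule: finite_induct)
  case empty
  then show ?case by (simp add: sum_spins_monomial_nonneg)
next
  case (insert e E)
  obtain a b where e: "e = (a, b)" and ab: "a < N" "b < N"
    using insert.prems(1) by (cases e) auto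
  define P where "P \<tau> = (\<Prod>e\<in>E. c e + s e * (\<tau> (fst e) * \<tau> (snd e)))" for \<tau> :: "nat \<Rightarrow> real"
  \<comment> \<open>Two separate indicators are added, so that a pair with \<open>a = b\<close>
    raises the exponent by 2.\<close>
  define m' where "m' i = m i + ((if i = a then 1 else 0) + (if i = b then 1 else 0))" for i
  have m': "(\<Prod>i<N. \<tau> i ^ m' i) = (\<Prod>i<N. \<tau> i ^ m i) * (\<tau> a * \<tau> b)" for \<tau> :: "nat \<Rightarrow> real"
    unfolding m'_def power_add prod.distrib using prod_power_indicator ab by simp
  have IH: "0 \<le> (\<Sum>\<tau>\<in>spins N. (\<Prod>i<N. \<tau> i ^ k i) * P \<tau>)" for k
    unfolding P_def by (rule insert.IH) (use insert.prems in auto)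
  have "0 \<le> c e * (\<Sum>\<tau>\<in>spins N. (\<Prod>i<N. \<tau> i ^ m i) * P \<tau>)
      + s e * (\<Sum>\<tau>\<in>spins N. (\<Prod>i<N. \<tau> i ^ m' i) * P \<tau>)"
    using insert.prems IH by (intro add_nonneg_nonneg mult_nonneg_nonneg) auto
  also have "\<dots> = (\<Sum>\<tau>\<in>spins N. (\<Prod>i<N. \<tau> i ^ m i) * ((c e + s e * (\<tau> a * \<tau> b)) * P \<tau>))"
    by (simp add: m' sum_distrib_left sum.distrib[symmetric] algebra_simps)
  finally show ?case
    using insert.hyps by (simp add: P_def e)
qed

lemma griffiths_lower_bound:
  assumes "finite E" "E \<subseteq> {..<N} \<times> {..<N}"
    and "\<And>e. e \<in> E \<Longrightarrow> 0 \<le> c e" "\<And>e. e \<in> E \<Longrightarrow> 0 \<le> s e"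
  shows "2 ^ N * (\<Prod>e\<in>E. c e) \<le> (\<Sum>\<tau>\<in>spins N. \<Prod>e\<in>E. c e + s e * (\<tau> (fst e) * \<tau> (snd e)))"
  using assms
proof (induction E rule: finite_induct)
  case empty
  then show ?case by (simp add: card_spins)
next
  case (insert e E)
  obtain a b where e: "e = (a, b)" and ab: "a < N" "b < N"
    using insert.prems(1) by (cases e) auto
  define P where "P \<tau> = (\<Prod>e\<in>E. c e + s e * (\<tau> (fst e) * \<tau> (snd e)))" for \<tau> :: "nat \<Rightarrow> real"
  have nonneg: "0 \<le> (\<Sum>\<tau>\<in>spins N. (\<tau> a * \<tau> b) * P \<tau>)"
  proof -
    define m :: "nat \<Rightarrow> nat" where "m i = (if i = a then 1 else 0) + (if i = b then 1 else 0)" for i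
    have "(\<Prod>i<N. \<tau> i ^ m i) = \<tau> a * \<tau> b" for \<tau> :: "nat \<Rightarrow> real"
      unfolding m_def power_add prod.distrib using prod_power_indicator ab by simp
    then show ?thesis
      using griffiths_nonneg[OF insert.hyps(1), of N c s m] insert.prems by (simp add: P_def e)
  qed
  have "2 ^ N * (\<Prod>e\<in>insert e E. c e) = c e * (2 ^ N * (\<Prod>e\<in>E. c e))"
    using insert.hyps by simp
  also have "\<dots> \<le> c e * (\<Sum>\<tau>\<in>spins N. P \<tau>)"
    unfolding P_def using insert by (intro mult_left_mono insert.IH) auto
  also have "\<dots> \<le> c e * (\<Sum>\<tau>\<in>spins N. P \<tau>) + s e * (\<Sum>\<tau>\<in>spins N. (\<tau> a * \<tau> b) * P \<tau>)"
    using nonneg insert.prems by (simp add: e)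
  also have "\<dots> = (\<Sum>\<tau>\<in>spins N. (c e + s e * (\<tau> a * \<tau> b)) * P \<tau>)"
    by (simp add: sum_distrib_left sum.distrib[symmetric] algebra_simps)
  finally show ?case
    using insert.hyps by (simp add: P_def e)
qed

text \<open>The factor 2 cancels the 1/2 in the exponent of the partition function, so each
  unordered pair carries weight \<beta> times its coupling.\<close>

lemma sum_symmetric_zero_diagonal:
  fixes f :: "nat \<Rightarrow> nat \<Rightarrow> real"
  assumes "\<And>i j. i < N \<Longrightarrow> j < N \<Longrightarrow> f i j = f j i" "\<And>i. i < N \<Longrightarrow> f i i = 0"
  shows "(\<Sum>i<N. \<Sum>j<N. f i j) = 2 * (\<Sum>(i, j)\<in>{(i, j). i < j \<and> j < N}. f i j)"
  using assms
proof (induction N)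
  case 0
  then show ?case by simp
next
  case (Suc N)
  have IH: "(\<Sum>i<N. \<Sum>j<N. f i j) = 2 * (\<Sum>(i, j)\<in>{(i, j). i < j \<and> j < N}. f i j)"
    using Suc by simp
  have set: "{(i, j). i < j \<and> j < Suc N} = {(i, j). i < j \<and> j < N} \<union> (\<lambda>i. (i, N)) ` {..<N}"
    by auto
  have fin: "finite {(i, j). i < j \<and> j < N}"
    by (rule finite_subset[of _ "{..<N} \<times> {..<N}"]) auto
  have "(\<Sum>(i, j)\<in>{(i, j). i < j \<and> j < Suc N}. f i j)
      = (\<Sum>(i, j)\<in>{(i, j). i < j \<and> j < N}. f i j) + (\<Sum>(i, j)\<in>(\<lambda>i. (i, N)) ` {..<N}. f i j)"
    unfolding set using fin by (intro sum.union_disjoint) auto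
  also have "(\<Sum>(i, j)\<in>(\<lambda>i. (i, N)) ` {..<N}. f i j) = (\<Sum>i<N. f i N)"
    by (subst sum.reindex) (auto simp: inj_on_def)
  finally have pairs: "(\<Sum>(i, j)\<in>{(i, j). i < j \<and> j < Suc N}. f i j)
      = (\<Sum>(i, j)\<in>{(i, j). i < j \<and> j < N}. f i j) + (\<Sum>i<N. f i N)" .
  have "(\<Sum>j<N. f N j) = (\<Sum>i<N. f i N)"
    using Suc.prems(1) by (intro sum.cong) auto
  then show ?case
    unfolding pairs using IH Suc.prems(2)[of N] by (simp add: sum.distrib)
qed

lemma log_partition_ge_sum_ln_cosh:
  assumes J: "J \<in> carrier_mat N N" and sym: "transpose_mat J = J"
    and diag: "\<And>i. i < N \<Longrightarrow> J $$ (i, i) = 0"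
    and nonneg: "\<And>i j. i < N \<Longrightarrow> j < N \<Longrightarrow> 0 \<le> J $$ (i, j)"
    and "0 < \<beta>"
  shows "(\<Sum>(i, j)\<in>{(i, j). i < j \<and> j < N}. ln (cosh (\<beta> * J $$ (i, j)))) \<le> log_partition N J \<beta>"
proof -
  let ?E = "{(i, j). i < j \<and> j < N}"
  have fin: "finite ?E"
    by (rule finite_subset[of _ "{..<N} \<times> {..<N}"]) auto
  have exp_spin: "exp (x * y) = cosh x + sinh x * y" if "y = -1 \<or> y = 1" for x y :: real
    using that by (auto simp: cosh_plus_sinh cosh_minus_sinh)
  have weight: "exp (1 / 2 * \<beta> * quad_form N J \<tau>)
      = (\<Prod>e\<in>?E. cosh (\<beta> * J $$ e) + sinh (\<beta> * J $$ e) * (\<tau> (fst e) * \<tau> (snd e)))"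
    if \<tau>: "\<tau> \<in> spins N" for \<tau>
  proof -
    have "quad_form N J \<tau> = 2 * (\<Sum>(i, j)\<in>?E. J $$ (i, j) * \<tau> i * \<tau> j)"
      unfolding quad_form_def
      by (rule sum_symmetric_zero_diagonal) (auto simp: symmetric_mat_index[OF J sym] diag)
    then have "1 / 2 * \<beta> * quad_form N J \<tau> = \<beta> * (\<Sum>(i, j)\<in>?E. J $$ (i, j) * \<tau> i * \<tau> j)"
      by simp
    also have "\<dots> = (\<Sum>e\<in>?E. \<beta> * J $$ e * (\<tau> (fst e) * \<tau> (snd e)))"
      unfolding sum_distrib_left by (intro sum.cong) auto
    finally have "exp (1 / 2 * \<beta> * quad_form N J \<tau>)
        = exp (\<Sum>e\<in>?E. \<beta> * J $$ e * (\<tau> (fst e) * \<tau> (snd e)))"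
      by (rule arg_cong)
    also have "\<dots> = (\<Prod>e\<in>?E. exp (\<beta> * J $$ e * (\<tau> (fst e) * \<tau> (snd e))))"
      using fin by (rule exp_sum)
    also have "\<dots> = (\<Prod>e\<in>?E. cosh (\<beta> * J $$ e) + sinh (\<beta> * J $$ e) * (\<tau> (fst e) * \<tau> (snd e)))"
    proof (rule prod.cong[OF refl], rule exp_spin)
      fix e assume "e \<in> ?E"
      then have "fst e < N" "snd e < N" by auto
      then show "\<tau> (fst e) * \<tau> (snd e) = -1 \<or> \<tau> (fst e) * \<tau> (snd e) = 1"
        using spins_values[OF \<tau>, of "fst e"] spins_values[OF \<tau>, of "snd e"] by auto
    qed
    finally show ?thesis .
  qed
  have "2 ^ N * (\<Prod>e\<in>?E. cosh (\<beta> * J $$ e)) \<le> (\<Sum>\<tau>\<in>spins N. exp (1 / 2 * \<beta> * quad_form N J \<tau>))"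
  proof -
    have "2 ^ N * (\<Prod>e\<in>?E. cosh (\<beta> * J $$ e))
        \<le> (\<Sum>\<tau>\<in>spins N. \<Prod>e\<in>?E. cosh (\<beta> * J $$ e) + sinh (\<beta> * J $$ e) * (\<tau> (fst e) * \<tau> (snd e)))"
      using nonneg \<open>0 < \<beta>\<close> by (intro griffiths_lower_bound[OF fin]) auto
    also have "\<dots> = (\<Sum>\<tau>\<in>spins N. exp (1 / 2 * \<beta> * quad_form N J \<tau>))"
      by (intro sum.cong refl weight[symmetric])
    finally show ?thesis .
  qed
  then have "(\<Prod>e\<in>?E. cosh (\<beta> * J $$ e)) \<le> 1 / 2 ^ N * (\<Sum>\<tau>\<in>spins N. exp (1 / 2 * \<beta> * quad_form N J \<tau>))"
    by (simp add: field_simps)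
  moreover have "0 < (\<Prod>e\<in>?E. cosh (\<beta> * J $$ e))"
    by (simp add: prod_pos)
  moreover have "(\<Sum>(i, j)\<in>?E. ln (cosh (\<beta> * J $$ (i, j)))) = ln (\<Prod>e\<in>?E. cosh (\<beta> * J $$ e))"
    using fin by (subst ln_prod) (auto simp: case_prod_unfold)
  ultimately show ?thesis
    unfolding log_partition_def by (simp only: ln_mono)
qed

subsection \<open>Averaging out the last spin\<close>

text \<open>For \<open>x \<ge> 0\<close>, compare derivatives twice: \<open>y - tanh y\<close> has
  derivative \<open>tanh y ^ 2\<close>, hence is non-negative, and it is itself the derivative of
  \<open>y\<^sup>2 / 2 - ln (cosh y)\<close>. Evenness covers negative \<open>x\<close>.\<close>

lemma cosh_le_exp_square_half: "cosh x \<le> exp (x\<^sup>2 / 2)" for x :: real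
proof -
  have tanh_le: "tanh x \<le> x" if "x \<ge> 0" for x :: real
  proof -
    have "(0::real) - tanh 0 \<le> x - tanh x"
    proof (rule DERIV_nonneg_imp_nondecreasing[OF that])
      fix y :: real
      show "\<exists>D. ((\<lambda>y. y - tanh y) has_real_derivative D) (at y) \<and> 0 \<le> D"
        by (rule exI[of _ "tanh y ^ 2"]) (auto intro!: derivative_eq_intros)
    qed
    then show ?thesis by simp
  qed
  have nonneg: "cosh x \<le> exp (x\<^sup>2 / 2)" if "x \<ge> 0" for x :: real
  proof -
    have "0\<^sup>2 / 2 - ln (cosh (0::real)) \<le> x\<^sup>2 / 2 - ln (cosh x)"
    proof (rule DERIV_nonneg_imp_nondecreasing[OF that])
      fix y :: real
      assume "0 \<le> y"
      then show "\<exists>D. ((\<lambda>y. y\<^sup>2 / 2 - ln (cosh y)) has_real_derivative D) (at y) \<and> 0 \<le> D"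
        using tanh_le[of y]
        by (intro exI[of _ "y - tanh y"])
          (auto intro!: derivative_eq_intros simp: tanh_def field_simps)
    qed
    then have "ln (cosh x) \<le> x\<^sup>2 / 2" by simp
    then have "exp (ln (cosh x)) \<le> exp (x\<^sup>2 / 2)" by (simp only: exp_le_cancel_iff)
    then show ?thesis by (simp only: exp_ln cosh_real_pos)
  qed
  from nonneg[of "\<bar>x\<bar>"] show ?thesis by (cases "x \<ge> 0") auto
qed

text \<open>Block elimination with the last diagonal entry as pivot: the matrix is
  \<open>?U * ?L\<close>, where \<open>?U\<close> is unit upper triangular and holds the last column
  divided by the pivot, and \<open>?L\<close> is block lower triangular with the Schur complement
  and the pivot on its diagonal.\<close>

lemma det_mat_Suc_schur:
  fixes A :: "nat \<Rightarrow> nat \<Rightarrow> 'a :: field"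
  assumes "A n n \<noteq> 0"
  shows "det (mat (Suc n) (Suc n) (\<lambda>(i, j). A i j)) =
    A n n * det (mat n n (\<lambda>(i, j). A i j - A i n * A n j / A n n))"
proof -
  let ?S = "mat n n (\<lambda>(i, j). A i j - A i n * A n j / A n n)"
  let ?B = "mat n 1 (\<lambda>(i, j). A i n / A n n)"
  let ?C = "mat 1 n (\<lambda>(i, j). A n j)" and ?D = "mat 1 1 (\<lambda>_. A n n)"
  let ?U = "four_block_mat (1\<^sub>m n) ?B (0\<^sub>m 1 n) (1\<^sub>m 1)"
  let ?L = "four_block_mat ?S (0\<^sub>m n 1) ?C ?D"
  have "mat (Suc n) (Suc n) (\<lambda>(i, j). A i j) = ?U * ?L"
    by (subst mult_four_block_mat[of _ n n _ 1 _ 1 _ _ n _ 1])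
      (use assms in \<open>auto intro!: eq_matI simp: four_block_mat_def Let_def scalar_prod_def less_Suc_eq\<close>)
  moreover have "det ?U = 1"
    by (subst det_four_block_mat_lower_left_zero[of _ n _ 1]) auto
  moreover have "det ?L = det ?S * A n n"
    by (subst det_four_block_mat_upper_right_zero[of _ n _ 1]) (auto simp: det_single)
  moreover have "det (?U * ?L) = det ?U * det ?L"
    by (rule det_mult[of _ "n + 1"]) auto
  ultimately show ?thesis by simp
qed

lemma spins_0: "spins 0 = {\<lambda>_. undefined}"
  by (auto simp: spins_def)

lemma sum_spins_Suc:
  fixes f :: "(nat \<Rightarrow> real) \<Rightarrow> 'a :: comm_monoid_add"
  shows "(\<Sum>\<tau>\<in>spins (Suc N). f \<tau>) = (\<Sum>\<tau>\<in>spins N. f (\<tau>(N := -1)) + f (\<tau>(N := 1)))"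
proof -
  have eq: "spins (Suc N) = (\<lambda>(y, g). g(N := y)) ` ({-1, 1} \<times> spins N)"
    by (simp add: spins_def lessThan_Suc PiE_insert_eq)
  have inj: "inj_on (\<lambda>(y, g). g(N := y)) ({-1, 1::real} \<times> spins N)"
    unfolding spins_def by (rule inj_combinator) simp
  show ?thesis
    unfolding eq sum.reindex[OF inj] by (simp add: sum.cartesian_product' sum.distrib)
qed

text \<open>The third assumption is positive definiteness of \<open>I - A\<close>. The diagonal is
  only required to be non-negative, because the induction step adds the square of
  \<open>A i N\<close> over \<open>1 - a\<close> to \<open>A i i\<close> and so destroys a zero
  diagonal. Positivity of the determinant is carried along to keep the square root
  meaningful.\<close>

lemma spin_sum_le_inverse_sqrt_det:
  fixes A :: "nat \<Rightarrow> nat \<Rightarrow> real"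
  assumes "\<And>i j. i < N \<Longrightarrow> j < N \<Longrightarrow> A i j = A j i" "\<And>i. i < N \<Longrightarrow> 0 \<le> A i i"
    and "\<And>x. \<exists>i<N. x i \<noteq> 0 \<Longrightarrow> (\<Sum>i<N. \<Sum>j<N. A i j * x i * x j) < (\<Sum>i<N. (x i)\<^sup>2)"
  defines "D \<equiv> det (mat N N (\<lambda>(i, j). of_bool (i = j) - A i j))"
  shows "0 < D \<and>
    (\<Sum>\<tau>\<in>spins N. exp (1 / 2 * (\<Sum>i<N. \<Sum>j<N. A i j * \<tau> i * \<tau> j))) / 2 ^ N \<le> 1 / sqrt D"
  using assms(1-3) unfolding D_def
proof (induction N arbitrary: A)
  case 0
  then show ?case by (simp add: spins_0)
next
  case (Suc N)
  define a where "a = A N N"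
  define S where "S x = (\<Sum>i<N. A i N * x i)" for x :: "nat \<Rightarrow> real"
  define Q where "Q x = (\<Sum>i<N. \<Sum>j<N. A i j * x i * x j)" for x :: "nat \<Rightarrow> real"
  define A' where "A' i j = A i j + A i N * A j N / (1 - a)" for i j
  define D where "D = det (mat N N (\<lambda>(i, j). of_bool (i = j) - A' i j))"
  have Q_Suc: "(\<Sum>i<Suc N. \<Sum>j<Suc N. A i j * x i * x j) = Q x + 2 * x N * S x + a * (x N)\<^sup>2" for x
  proof -
    have "(\<Sum>i<N. A N i * x N * x i) = x N * S x"
      unfolding S_def sum_distrib_left using Suc.prems(1) by (intro sum.cong) auto
    moreover have "(\<Sum>i<N. A i N * x i * x N) = x N * S x"
      unfolding S_def sum_distrib_left by (simp add: mult_ac)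
    ultimately show ?thesis
      by (simp add: Q_def a_def sum.distrib power2_eq_square algebra_simps)
  qed
  have "0 \<le> a"
    unfolding a_def using Suc.prems(2) by simp
  \<comment> \<open>Positive definiteness is tested on the last unit vector.\<close>
  have "a < 1"
    using Suc.prems(3)[of "\<lambda>i. of_bool (i = N)"] unfolding Q_Suc by (auto simp: Q_def S_def)
  have Q': "(\<Sum>i<N. \<Sum>j<N. A' i j * x i * x j) = Q x + (S x)\<^sup>2 / (1 - a)" for x
  proof -
    have "(S x)\<^sup>2 = (\<Sum>i<N. \<Sum>j<N. A i N * A j N * x i * x j)"
      unfolding S_def power2_eq_square sum_product by (simp add: mult_ac)
    then show ?thesis
      by (simp add: A'_def Q_def sum.distrib algebra_simps sum_divide_distrib)
  qed
  have IH: "0 < D \<and> (\<Sum>\<tau>\<in>spins N. exp (1 / 2 * (Q \<tau> + (S \<tau>)\<^sup>2 / (1 - a)))) / 2 ^ N \<le> 1 / sqrt D"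
    unfolding D_def Q'[symmetric]
  proof (rule Suc.IH)
    fix x :: "nat \<Rightarrow> real"
    assume x: "\<exists>i<N. x i \<noteq> 0"
    \<comment> \<open>the last coordinate minimises the form of \<open>I - A\<close>, which leaves the Schur complement\<close>
    define y where "y = x(N := S x / (1 - a))"
    have y: "Q y = Q x" "S y = S x" "(\<Sum>i<N. (y i)\<^sup>2) = (\<Sum>i<N. (x i)\<^sup>2)" "y N = S x / (1 - a)"
      unfolding Q_def S_def y_def by (auto intro!: sum.cong)
    have "\<exists>i<Suc N. y i \<noteq> 0"
      using x by (auto simp: y_def intro: less_SucI)
    from Suc.prems(3)[OF this] have "Q x + 2 * y N * S x + a * (y N)\<^sup>2 < (\<Sum>i<N. (x i)\<^sup>2) + (y N)\<^sup>2"
      unfolding Q_Suc by (simp add: y)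
    moreover have "2 * y N * S x + a * (y N)\<^sup>2 - (y N)\<^sup>2 = (S x)\<^sup>2 / (1 - a)"
      unfolding y(4) using \<open>a < 1\<close> by (simp add: divide_simps power2_eq_square) (simp add: algebra_simps)
    ultimately show "(\<Sum>i<N. \<Sum>j<N. A' i j * x i * x j) < (\<Sum>i<N. (x i)\<^sup>2)"
      unfolding Q' by linarith
  qed (use Suc.prems(1,2) \<open>a < 1\<close> in \<open>auto simp: A'_def mult_ac\<close>)
  have "det (mat (Suc N) (Suc N) (\<lambda>(i, j). of_bool (i = j) - A i j))
      = (1 - a) * det (mat N N (\<lambda>(i, j). of_bool (i = j) - A i j
          - (of_bool (i = N) - A i N) * (of_bool (N = j) - A N j) / (1 - a)))"
    using det_mat_Suc_schur[of "\<lambda>i j. of_bool (i = j) - A i j" N] \<open>a < 1\<close> by (simp add: a_def)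
  \<comment> \<open>Indices stay below \<open>N\<close>, so both indicators vanish and the two minus
    signs cancel; symmetry turns \<open>A N j\<close> into \<open>A j N\<close>.\<close>
  also have "mat N N (\<lambda>(i, j). of_bool (i = j) - A i j
          - (of_bool (i = N) - A i N) * (of_bool (N = j) - A N j) / (1 - a))
      = mat N N (\<lambda>(i, j). of_bool (i = j) - A' i j)"
    using Suc.prems(1) by (intro eq_matI) (auto simp: A'_def)
  finally have det: "det (mat (Suc N) (Suc N) (\<lambda>(i, j). of_bool (i = j) - A i j)) = (1 - a) * D"
    unfolding D_def .
  \<comment> \<open>The two summands are the weights of the last spin being -1 and 1. Its square is
    1 in both, so the diagonal entry contributes the same \<open>a\<close>. The bound combines
    \<open>1 - a \<le> exp (-a)\<close> with the Gaussian bound on \<open>cosh\<close>.\<close>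
  have avg: "exp (1 / 2 * (q - 2 * s + a)) + exp (1 / 2 * (q + 2 * s + a))
      \<le> 2 / sqrt (1 - a) * exp (1 / 2 * (q + s\<^sup>2 / (1 - a)))" for q s
  proof -
    have "sqrt (1 - a) \<le> sqrt (exp (-a))"
      using exp_ge_add_one_self[of "-a"] by (intro real_sqrt_le_mono) simp
    also have "\<dots> = exp (- (a / 2))"
      by (intro real_sqrt_unique) (auto simp: power2_eq_square exp_add[symmetric])
    finally have a: "exp (a / 2) \<le> 1 / sqrt (1 - a)"
      using \<open>a < 1\<close> by (simp add: exp_minus field_simps)
    \<comment> \<open>Here \<open>0 \<le> a\<close> enters: dividing by \<open>1 - a\<close> can
      only enlarge the exponent.\<close>
    have "s\<^sup>2 * (1 - a) \<le> s\<^sup>2"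
      using \<open>0 \<le> a\<close> by (simp add: algebra_simps)
    then have "s\<^sup>2 / 2 \<le> s\<^sup>2 / (1 - a) / 2"
      using \<open>a < 1\<close> by (simp add: pos_le_divide_eq algebra_simps)
    then have s: "cosh s \<le> exp (s\<^sup>2 / (1 - a) / 2)"
      using cosh_le_exp_square_half[of s] by (meson exp_le_cancel_iff order_trans)
    have "exp (1 / 2 * (q - 2 * s + a)) + exp (1 / 2 * (q + 2 * s + a)) = 2 * exp (q / 2) * (exp (a / 2) * cosh s)"
      by (simp add: cosh_def exp_add[symmetric] algebra_simps add_divide_distrib diff_divide_distrib)
    also have "\<dots> \<le> 2 * exp (q / 2) * (1 / sqrt (1 - a) * exp (s\<^sup>2 / (1 - a) / 2))"
      using a s \<open>a < 1\<close> by (intro mult_left_mono mult_mono) auto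
    also have "\<dots> = 2 / sqrt (1 - a) * exp (1 / 2 * (q + s\<^sup>2 / (1 - a)))"
      by (simp add: exp_add add_divide_distrib)
    finally show ?thesis .
  qed
  have upd: "Q (\<tau>(N := c)) = Q \<tau>" "S (\<tau>(N := c)) = S \<tau>" for \<tau> c
    unfolding Q_def S_def by (auto intro!: sum.cong)
  have "(\<Sum>\<tau>\<in>spins (Suc N). exp (1 / 2 * (\<Sum>i<Suc N. \<Sum>j<Suc N. A i j * \<tau> i * \<tau> j)))
      = (\<Sum>\<tau>\<in>spins N. exp (1 / 2 * (Q \<tau> - 2 * S \<tau> + a)) + exp (1 / 2 * (Q \<tau> + 2 * S \<tau> + a)))"
    unfolding sum_spins_Suc Q_Suc upd by simp
  also have "\<dots> \<le> (\<Sum>\<tau>\<in>spins N. 2 / sqrt (1 - a) * exp (1 / 2 * (Q \<tau> + (S \<tau>)\<^sup>2 / (1 - a))))"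
    by (intro sum_mono avg)
  also have "\<dots> = 2 / sqrt (1 - a) * (\<Sum>\<tau>\<in>spins N. exp (1 / 2 * (Q \<tau> + (S \<tau>)\<^sup>2 / (1 - a))))"
    by (rule sum_distrib_left[symmetric])
  finally have "(\<Sum>\<tau>\<in>spins (Suc N). exp (1 / 2 * (\<Sum>i<Suc N. \<Sum>j<Suc N. A i j * \<tau> i * \<tau> j))) / 2 ^ Suc N
      \<le> 1 / sqrt (1 - a) * ((\<Sum>\<tau>\<in>spins N. exp (1 / 2 * (Q \<tau> + (S \<tau>)\<^sup>2 / (1 - a)))) / 2 ^ N)"
    by (simp add: field_simps)
  also have "\<dots> \<le> 1 / sqrt (1 - a) * (1 / sqrt D)"
    using IH \<open>a < 1\<close> by (intro mult_left_mono) auto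
  finally show ?case
    unfolding det using IH \<open>a < 1\<close> by (simp add: real_sqrt_mult)
qed

subsection \<open>Operator norm and spectrum\<close>

lemma vec_l2_norm_eq_L2_set: "vec_l2_norm v = L2_set (($) v) {..<dim_vec v}"
  by (simp add: vec_l2_norm_def L2_set_def scalar_prod_def power2_eq_square lessThan_atLeast0)

lemma vec_l2_norm_smult: "vec_l2_norm (c \<cdot>\<^sub>v v) = \<bar>c\<bar> * vec_l2_norm v"
  by (simp add: vec_l2_norm_def scalar_prod_def real_sqrt_mult[symmetric] sum_distrib_left
      power_mult_distrib flip: real_sqrt_abs power2_eq_square)

text \<open>A real supremum bounds its members only once the set is known to be bounded above.
  Coordinates of a vector in the unit ball are at most 1 in modulus, so the sum of all absolute
  entries is a bound.\<close>

lemma bdd_above_l2_op_norm: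
  "bdd_above ((\<lambda>v. vec_l2_norm (A *\<^sub>v v)) ` {v \<in> carrier_vec (dim_col A). vec_l2_norm v \<le> 1})"
proof (rule bdd_aboveI2)
  fix v assume v: "v \<in> {v \<in> carrier_vec (dim_col A). vec_l2_norm v \<le> 1}"
  have entry: "\<bar>v $ j\<bar> \<le> 1" if "j < dim_col A" for j
  proof -
    have "\<bar>v $ j\<bar> \<le> L2_set (\<lambda>j. \<bar>v $ j\<bar>) {..<dim_col A}"
      using that by (intro member_le_L2_set) auto
    also have "\<dots> = vec_l2_norm v"
      using v by (auto simp: vec_l2_norm_eq_L2_set L2_set_def)
    finally show ?thesis using v by simp
  qed
  have "vec_l2_norm (A *\<^sub>v v) \<le> (\<Sum>i<dim_row A. \<bar>(A *\<^sub>v v) $ i\<bar>)"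
    unfolding vec_l2_norm_eq_L2_set by (simp add: L2_set_le_sum_abs del: index_mult_mat_vec)
  also have "\<dots> \<le> (\<Sum>i<dim_row A. \<Sum>j<dim_col A. \<bar>A $$ (i, j)\<bar>)"
  proof (rule sum_mono)
    fix i assume "i \<in> {..<dim_row A}"
    then have "\<bar>(A *\<^sub>v v) $ i\<bar> = \<bar>\<Sum>j<dim_col A. A $$ (i, j) * v $ j\<bar>"
      using v by (auto simp: scalar_prod_def lessThan_atLeast0)
    also have "\<dots> \<le> (\<Sum>j<dim_col A. \<bar>A $$ (i, j) * v $ j\<bar>)"
      by (rule sum_abs)
    also have "\<dots> \<le> (\<Sum>j<dim_col A. \<bar>A $$ (i, j)\<bar>)"
      using entry by (intro sum_mono) (auto simp: abs_mult intro: mult_left_le)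
    finally show "\<bar>(A *\<^sub>v v) $ i\<bar> \<le> (\<Sum>j<dim_col A. \<bar>A $$ (i, j)\<bar>)" .
  qed
  finally show "vec_l2_norm (A *\<^sub>v v) \<le> (\<Sum>i<dim_row A. \<Sum>j<dim_col A. \<bar>A $$ (i, j)\<bar>)" .
qed

lemma vec_l2_norm_nonneg: "0 \<le> vec_l2_norm v"
  by (simp add: vec_l2_norm_eq_L2_set)

lemma l2_op_norm_nonneg: "0 \<le> l2_op_norm A"
proof -
  have "vec_l2_norm (A *\<^sub>v 0\<^sub>v (dim_col A)) \<le> l2_op_norm A"
    unfolding l2_op_norm_def
    by (rule cSUP_upper[OF _ bdd_above_l2_op_norm]) (simp add: vec_l2_norm_def)
  with vec_l2_norm_nonneg show ?thesis by (rule order_trans)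
qed

text \<open>A nonzero vector is rescaled to norm 1; a vector of norm 0 is the zero vector.\<close>

lemma vec_l2_norm_mult_mat_vec_le:
  assumes v: "v \<in> carrier_vec (dim_col A)"
  shows "vec_l2_norm (A *\<^sub>v v) \<le> l2_op_norm A * vec_l2_norm v"
proof (cases "vec_l2_norm v = 0")
  case True
  then have "v = 0\<^sub>v (dim_col A)"
    using v by (auto simp: vec_l2_norm_eq_L2_set L2_set_eq_0_iff)
  moreover have "A *\<^sub>v 0\<^sub>v (dim_col A) = 0\<^sub>v (dim_row A)"
    by auto
  ultimately show ?thesis using True by (simp add: vec_l2_norm_def)
next
  case False
  then have pos: "0 < vec_l2_norm v"
    using vec_l2_norm_nonneg[of v] by simp
  let ?w = "(1 / vec_l2_norm v) \<cdot>\<^sub>v v"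
  have "vec_l2_norm (A *\<^sub>v ?w) \<le> l2_op_norm A"
    unfolding l2_op_norm_def using v pos
    by (intro cSUP_upper[OF _ bdd_above_l2_op_norm]) (auto simp: vec_l2_norm_smult)
  moreover have "A *\<^sub>v ?w = (1 / vec_l2_norm v) \<cdot>\<^sub>v (A *\<^sub>v v)"
    using v by (intro mult_mat_vec) auto
  ultimately show ?thesis
    using pos by (simp add: vec_l2_norm_smult field_simps)
qed

text \<open>Cauchy-Schwarz applied to \<open>x\<close> and its image under \<open>J\<close>,
  followed by the operator norm bound.\<close>

lemma quad_form_le_l2_op_norm:
  assumes J: "J \<in> carrier_mat N N"
  shows "quad_form N J x \<le> l2_op_norm J * (\<Sum>i<N. (x i)\<^sup>2)"
proof -
  let ?v = "vec N x"
  have norm: "vec_l2_norm ?v = L2_set x {..<N}"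
    unfolding vec_l2_norm_eq_L2_set by (auto intro: L2_set_cong)
  have "quad_form N J x = (\<Sum>i<N. x i * (J *\<^sub>v ?v) $ i)"
    using J by (auto simp: quad_form_def scalar_prod_def lessThan_atLeast0 sum_distrib_left mult_ac intro!: sum.cong)
  also have "\<dots> \<le> (\<Sum>i<N. \<bar>x i\<bar> * \<bar>(J *\<^sub>v ?v) $ i\<bar>)"
    by (intro sum_mono) (simp flip: abs_mult)
  also have "\<dots> \<le> L2_set x {..<N} * L2_set (($) (J *\<^sub>v ?v)) {..<N}"
    by (rule L2_set_mult_ineq)
  also have "L2_set (($) (J *\<^sub>v ?v)) {..<N} = vec_l2_norm (J *\<^sub>v ?v)"
    using J by (simp add: vec_l2_norm_eq_L2_set del: index_mult_mat_vec)
  also have "L2_set x {..<N} * \<dots> \<le> L2_set x {..<N} * (l2_op_norm J * L2_set x {..<N})"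
    using vec_l2_norm_mult_mat_vec_le[of ?v J] J norm by (intro mult_left_mono) auto
  also have "\<dots> = l2_op_norm J * (\<Sum>i<N. (x i)\<^sup>2)"
    by (simp add: L2_set_def sum_nonneg)
  finally show ?thesis .
qed

section \<open>Real spectrum and characteristic polynomial\<close>

text \<open>The polynomial splits over the complex numbers, the Hermitian argument makes every root
  real, and the factorisation descends because the embedding of the reals is injective on
  coefficients.\<close>

lemma char_poly_real_symmetric:
  fixes J :: "real mat"
  assumes J: "J \<in> carrier_mat N N" and sym: "transpose_mat J = J"
  shows "\<exists>es. char_poly J = (\<Prod>e\<leftarrow>es. [:- e, 1:]) \<and> length es = N"
proof -
  let ?C = "map_mat complex_of_real J"
  have C: "?C \<in> carrier_mat N N" using J by simp
  obtain as where as: "char_poly ?C = (\<Prod>a\<leftarrow>as. [:- a, 1:])" "length as = N"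
    using char_poly_factorized[OF C] by blast
  have real: "of_real (Re a) = a" if "a \<in> set as" for a
  proof -
    have "poly (char_poly ?C) a = 0"
      using that by (auto simp: as poly_prod_list prod_list_zero_iff)
    then obtain v where v: "v \<in> carrier_vec N" "v \<noteq> 0\<^sub>v N" and ev: "?C *\<^sub>v v = a \<cdot>\<^sub>v v"
      using eigenvalue_root_char_poly[OF C] C by (auto simp: eigenvalue_def eigenvector_def)
    have conj: "?C *\<^sub>v conjugate v = conjugate (?C *\<^sub>v v)"
      using v J by (intro eq_vecI) (auto simp: scalar_prod_def)
    have "transpose_mat ?C = ?C"
      by (metis sym map_mat_transpose)
    \<comment> \<open>Moving the symmetric matrix across the inner product gives \<open>a\<close> on
      one side and \<open>cnj a\<close> on the other, times a nonzero number.\<close>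
    then have "a * (v \<bullet>c v) = (transpose_mat ?C *\<^sub>v v) \<bullet> conjugate v"
      using v ev by simp
    also have "\<dots> = v \<bullet> (?C *\<^sub>v conjugate v)"
      using v C by (intro transpose_vec_mult_scalar) auto
    also have "\<dots> = cnj a * (v \<bullet>c v)"
      unfolding conj ev using v by (simp add: conjugate_smult_vec)
    finally have "a = cnj a"
      using v conjugate_square_eq_0_vec[OF v(1)] by simp
    then show ?thesis by (simp add: complex_eq_iff)
  qed
  interpret map_poly_hom: map_poly_comm_ring_hom complex_of_real ..
  have "map_poly complex_of_real (char_poly J) = char_poly ?C"
    by (rule of_real_hom.char_poly_hom[OF J, symmetric])
  also have "\<dots> = (\<Prod>a\<leftarrow>as. map_poly complex_of_real [:- Re a, 1:])"
    unfolding as using real by (intro arg_cong[of _ _ prod_list] map_cong) (auto simp: of_real_hom.map_poly_pCons_hom)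
  also have "\<dots> = map_poly complex_of_real (\<Prod>a\<leftarrow>as. [:- Re a, 1:])"
    by (simp add: map_poly_hom.hom_prod_list o_def)
  finally have "char_poly J = (\<Prod>a\<leftarrow>as. [:- Re a, 1:])"
    by (simp add: poly_eq_iff coeff_map_poly)
  then show ?thesis
    using as(2) by (intro exI[of _ "map Re as"]) (simp add: o_def)
qed

text \<open>Root multisets add under products and each linear factor contributes one root, so the
  sorted list is a rearrangement of \<open>es\<close>.\<close>

lemma mset_sorted_eigenvalues:
  assumes "char_poly A = (\<Prod>e\<leftarrow>es. [:- e, 1:])"
  shows "mset (sorted_eigenvalues A) = mset es"
proof -
  have "proots (\<Prod>e\<leftarrow>es. [:- e, 1:]) = (\<Sum>p\<leftarrow>map (\<lambda>e. [:- e, 1:]) es. proots p)"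
    by (subst proots_prod_list[symmetric]) (auto simp: o_def)
  also have "\<dots> = mset es"
    by (induction es) auto
  finally show ?thesis
    by (simp add: sorted_eigenvalues_def assms)
qed

text \<open>Pulling \<beta> out of the matrix leaves the characteristic polynomial at
  \<open>1 / \<beta>\<close>; the \<open>N\<close> powers of \<beta> are then shared among the
  \<open>N\<close> linear factors.\<close>

lemma det_one_minus_smult:
  fixes J :: "real mat"
  assumes J: "J \<in> carrier_mat N N" and es: "char_poly J = (\<Prod>e\<leftarrow>es. [:- e, 1:])" "length es = N"
    and "\<beta> \<noteq> 0"
  shows "det (1\<^sub>m N - \<beta> \<cdot>\<^sub>m J) = (\<Prod>e\<leftarrow>es. 1 - \<beta> * e)"
proof -
  have "1\<^sub>m N - \<beta> \<cdot>\<^sub>m J = \<beta> \<cdot>\<^sub>m (- char_matrix J (1 / \<beta>))"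
    using J \<open>\<beta> \<noteq> 0\<close> by (intro eq_matI) (auto simp: char_matrix_def algebra_simps)
  then have "det (1\<^sub>m N - \<beta> \<cdot>\<^sub>m J) = \<beta> ^ N * poly (char_poly J) (1 / \<beta>)"
    using J by (simp add: char_poly_matrix[OF J] char_matrix_def)
  also have "\<dots> = \<beta> ^ length es * (\<Prod>e\<leftarrow>es. 1 / \<beta> - e)"
    unfolding es by (simp add: poly_prod_list o_def es)
  also have "\<dots> = (\<Prod>e\<leftarrow>es. 1 - \<beta> * e)"
    using \<open>\<beta> \<noteq> 0\<close> by (induction es) (auto simp: algebra_simps)
  finally show ?thesis .
qed

text \<open>An eigenvector has Rayleigh quotient \<open>e\<close>, which turns bounds on the form
  into bounds on eigenvalues.\<close>

lemma eigenvalue_quad_form: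
  fixes J :: "real mat"
  assumes J: "J \<in> carrier_mat N N" and "poly (char_poly J) e = 0"
  obtains x where "\<exists>i<N. x i \<noteq> 0" "quad_form N J x = e * (\<Sum>i<N. (x i)\<^sup>2)"
proof -
  obtain v where v: "v \<in> carrier_vec N" "v \<noteq> 0\<^sub>v N" and ev: "J *\<^sub>v v = e \<cdot>\<^sub>v v"
    using assms eigenvalue_root_char_poly[OF J] by (auto simp: eigenvalue_def eigenvector_def)
  have "(\<Sum>j<N. J $$ (i, j) * v $ j) = e * v $ i" if "i < N" for i
    using arg_cong[OF ev, of "\<lambda>w. w $ i"] J v that by (simp add: scalar_prod_def lessThan_atLeast0)
  then have "(\<Sum>i<N. v $ i * (\<Sum>j<N. J $$ (i, j) * v $ j)) = (\<Sum>i<N. v $ i * (e * v $ i))"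
    by (intro sum.cong) auto
  then have "quad_form N J (($) v) = e * (\<Sum>i<N. (v $ i)\<^sup>2)"
    by (simp add: quad_form_def sum_distrib_left power2_eq_square mult_ac)
  moreover have "\<exists>i<N. v $ i \<noteq> 0"
    using v by (metis carrier_vecD eq_vecI index_zero_vec)
  ultimately show ?thesis using that by blast
qed

section \<open>Assembly of the spectral upper bound\<close>

lemma log_partition_le_spectral:
  assumes J: "J \<in> carrier_mat N N" and sym: "transpose_mat J = J"
    and diag: "\<And>i. i < N \<Longrightarrow> J $$ (i, i) = 0"
    and "0 < \<beta>" and small: "\<beta> * l2_op_norm J < 1"
  shows "log_partition N J \<beta> \<le> - (1 / 2) * (\<Sum>i<N. ln (1 - \<beta> * sorted_eigenvalues J ! i))"
proof -
  obtain es where es: "char_poly J = (\<Prod>e\<leftarrow>es. [:- e, 1:])" "length es = N"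
    using char_poly_real_symmetric[OF J sym] by blast
  have posdef: "\<beta> * quad_form N J x < (\<Sum>i<N. (x i)\<^sup>2)" if x: "\<exists>i<N. x i \<noteq> 0" for x
  proof -
    have "0 < (\<Sum>i<N. (x i)\<^sup>2)"
      using x by (auto intro: sum_pos2)
    have "\<beta> * quad_form N J x \<le> \<beta> * (l2_op_norm J * (\<Sum>i<N. (x i)\<^sup>2))"
      using quad_form_le_l2_op_norm[OF J] \<open>0 < \<beta>\<close> by simp
    also have "\<dots> < 1 * (\<Sum>i<N. (x i)\<^sup>2)"
      unfolding mult.assoc[symmetric] using small \<open>0 < (\<Sum>i<N. (x i)\<^sup>2)\<close>
      by (rule mult_strict_right_mono)
    finally show ?thesis by simp
  qed
  \<comment> \<open>Each factor must be positive, not just their product, for the logarithm of the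
    determinant to split into a sum.\<close>
  have factor_pos: "0 < 1 - \<beta> * e" if "e \<in> set es" for e
  proof -
    have "poly (char_poly J) e = 0"
      using that by (auto simp: es poly_prod_list prod_list_zero_iff)
    then obtain x where x: "\<exists>i<N. x i \<noteq> 0" "quad_form N J x = e * (\<Sum>i<N. (x i)\<^sup>2)"
      using eigenvalue_quad_form[OF J] by metis
    have "0 < (\<Sum>i<N. (x i)\<^sup>2)"
      using x(1) by (auto intro: sum_pos2)
    with posdef[OF x(1)] show ?thesis
      unfolding x(2) mult.assoc[symmetric] by (simp add: mult_less_cancel_right2)
  qed
  have quad: "(\<Sum>i<N. \<Sum>j<N. \<beta> * J $$ (i, j) * x i * x j) = \<beta> * quad_form N J x" for x
    by (simp add: quad_form_def sum_distrib_left mult_ac)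
  define D where "D = det (1\<^sub>m N - \<beta> \<cdot>\<^sub>m J)"
  have D_eq: "D = det (mat N N (\<lambda>(i, j). of_bool (i = j) - \<beta> * J $$ (i, j)))"
    unfolding D_def using J by (intro arg_cong[of _ _ det] eq_matI) auto
  have "0 < D \<and> (\<Sum>\<tau>\<in>spins N. exp (1 / 2 * (\<beta> * quad_form N J \<tau>))) / 2 ^ N \<le> 1 / sqrt D"
    using spin_sum_le_inverse_sqrt_det[of N "\<lambda>i j. \<beta> * J $$ (i, j)"] posdef
      symmetric_mat_index[OF J sym] diag
    unfolding D_eq quad by simp
  then have D: "0 < D" "1 / 2 ^ N * (\<Sum>\<tau>\<in>spins N. exp (1 / 2 * \<beta> * quad_form N J \<tau>)) \<le> 1 / sqrt D"
    by (simp_all add: mult.assoc)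
  have "0 < (\<Sum>\<tau>\<in>spins N. exp (1 / 2 * \<beta> * quad_form N J \<tau>))"
    by (intro sum_pos) (auto simp: spins_def PiE_eq_empty_iff intro!: finite_PiE)
  then have "log_partition N J \<beta> \<le> ln (1 / sqrt D)"
    unfolding log_partition_def using D by (intro ln_mono) auto
  also have "\<dots> = - (1 / 2) * ln D"
    using D(1) by (simp add: ln_div ln_sqrt)
  also have "ln D = (\<Sum>e\<leftarrow>es. ln (1 - \<beta> * e))"
  proof -
    have "D = (\<Prod>e\<leftarrow>es. 1 - \<beta> * e)"
      unfolding D_def using det_one_minus_smult[OF J es] \<open>0 < \<beta>\<close> by simp
    \<comment> \<open>Positivity of the product is part of the induction claim, since splitting off
      one more logarithm needs it.\<close>
    also have "ln \<dots> = (\<Sum>e\<leftarrow>es. ln (1 - \<beta> * e)) \<and> 0 < (\<Prod>e\<leftarrow>es. 1 - \<beta> * e)"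
      using factor_pos by (induction es) (fastforce simp: ln_mult_pos)+
    finally show ?thesis by simp
  qed
  also have "\<dots> = (\<Sum>i<N. ln (1 - \<beta> * sorted_eigenvalues J ! i))"
  proof -
    have mset: "mset (sorted_eigenvalues J) = mset es"
      using mset_sorted_eigenvalues[OF es(1)] .
    \<comment> \<open>With length exactly \<open>N\<close>, the indices below \<open>N\<close> run
      through the whole list.\<close>
    then have "length (sorted_eigenvalues J) = N"
      using es(2) by (metis size_mset)
    then have "(\<Sum>i<N. ln (1 - \<beta> * sorted_eigenvalues J ! i)) = (\<Sum>e\<leftarrow>sorted_eigenvalues J. ln (1 - \<beta> * e))"
      by (simp add: sum_list_sum_nth lessThan_atLeast0)
    also have "\<dots> = (\<Sum>e\<leftarrow>es. ln (1 - \<beta> * e))"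
      using mset by (metis mset_map sum_mset_sum_list)
    finally show ?thesis ..
  qed
  finally show ?thesis .
qed

lemma ereal_less_inverse_imp_mult_less_one:
  assumes "ereal b < 1 / ereal c" "0 \<le> c"
  shows "b * c < 1"
proof (cases "c = 0")
  case False
  with assms show ?thesis
    by (simp add: one_ereal_def field_simps)
qed simp

theorem lemma7p1:
  fixes N :: nat and J :: "real mat"
  assumes "J \<in> carrier_mat N N"
    and "transpose_mat J = J"
    and "\<And>i. i < N \<Longrightarrow> J $$ (i, i) = 0"
    and "\<And>i j. i < N \<Longrightarrow> j < N \<Longrightarrow> 0 \<le> J $$ (i, j)"
  shows "(\<forall>\<beta>::real. 0 < \<beta> \<and> ereal \<beta> < 1 / ereal (l2_op_norm J) \<longrightarrow>
            log_partition N J \<beta> \<le>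
              - (1 / 2) * (\<Sum>i<N. ln (1 - \<beta> * sorted_eigenvalues J ! i)))
       \<and> (\<forall>\<beta>::real. 0 < \<beta> \<longrightarrow>
            (\<Sum>(i, j) \<in> {(i, j). i < j \<and> j < N}. ln (cosh (\<beta> * J $$ (i, j))))
              \<le> log_partition N J \<beta>)"
  using log_partition_le_spectral[OF assms(1-3)] log_partition_ge_sum_ln_cosh[OF assms]
    ereal_less_inverse_imp_mult_less_one[OF _ l2_op_norm_nonneg]
  by blast

end
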